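(* Let $\mathcal{S}$ be either of the following sub-semigroups of $\mathcal{P}$: (i) $\mathcal{S} = \mathcal{P}^p$ for some real $p$ with $1 \le p < \infty$; (ii) $\mathcal{S} = \mathcal{P}_{\mathrm{Cram}}$. Then the monotone additive statistics $\varphi \colon \mathcal{S} \to \mathbb{R}$ are precisely the maps of the form $\varphi(\mu) = c\, \mathbb{E}[\mu]$ for some real constant $c \ge 0$.
   Context: $\mathcal{P}$ is the set of Borel probability measures on $\mathbb{R}$, a commutative semigroup under convolution $\ast$. A sub-semigroup of $\mathcal{P}$ is a subset closed under convolution. Stochastic order: $\mu \le \nu$ if and only if $\mu((-\infty,x]) \ge \nu((-\infty,x])$ for all $x \in \mathbb{R}$. For a sub-semigroup $\mathcal{S} \subseteq \mathcal{P}$, a map $\varphi \colon \mathcal{S} \to \mathbb{R}$ is an additive statistic if $\varphi(\mu \ast \nu) = \varphi(\mu) + \varphi(\nu)$ for all $\mu,\nu \in \mathcal{S}$. It is monotone if $\mu \le \nu$ implies $\varphi(\mu) \le \varphi(\nu)$ for all $\mu,\nu\in\mathcal{S}$. A monotone additive statistic on $\mathcal{S}$ is a map with both properties; no continuity or measurability is assumed. For $0 < p < \infty$, $\mathcal{P}^p$ is the sub-semigroup of all $\mu \in \mathcal{P}$ with $\int |x|^p \, \mathrm{d}\mu(x) < \infty$. $\mathcal{P}_{\mathrm{Cram}}$ is the sub-semigroup of all $\mu \in \mathcal{P}$ whose moment-generating function $M_\mu(t) = \int e^{tx}\,\mathrm{d}\mu(x)$ is finite for all $t$ in some neighborhood of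 $0$ (which may depend on $\mu$). $\mathbb{E}[\mu] = \int x\,\mathrm{d}\mu(x)$ is the expectation. *)

theory Defs
  imports "HOL-Probability.Probability"
begin

definition borel_prob_measures :: "real measure set" where
  "borel_prob_measures = {\<mu>. prob_space \<mu> \<and> sets \<mu> = sets borel}"

definition convolution_subsemigroup :: "real measure set \<Rightarrow> bool" where
  "convolution_subsemigroup S \<longleftrightarrow>
     S \<subseteq> borel_prob_measures \<and> (\<forall>\<mu>\<in>S. \<forall>\<nu>\<in>S. (\<mu> \<star> \<nu>) \<in> S)"

definition stoch_le :: "real measure \<Rightarrow> real measure \<Rightarrow> bool" where
  "stoch_le \<mu> \<nu> \<longleftrightarrow> (\<forall>x. cdf \<mu> x \<ge> cdf \<nu> x)"

text \<open>Statistics on \<open>S\<close> are total functions of which only the values on \<open>S\<close> matter.\<close>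

definition additive_statistic :: "real measure set \<Rightarrow> (real measure \<Rightarrow> real) \<Rightarrow> bool" where
  "additive_statistic S \<phi> \<longleftrightarrow> (\<forall>\<mu>\<in>S. \<forall>\<nu>\<in>S. \<phi> (\<mu> \<star> \<nu>) = \<phi> \<mu> + \<phi> \<nu>)"

definition monotone_additive_statistic :: "real measure set \<Rightarrow> (real measure \<Rightarrow> real) \<Rightarrow> bool" where
  "monotone_additive_statistic S \<phi> \<longleftrightarrow>
     additive_statistic S \<phi> \<and> monotone_on S stoch_le (\<le>) \<phi>"

definition finite_moment_measures :: "real \<Rightarrow> real measure set" where
  "finite_moment_measures p =
     {\<mu> \<in> borel_prob_measures. (\<integral>\<^sup>+ x. ennreal (\<bar>x\<bar> powr p) \<partial>\<mu>) < \<infinity>}"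

definition moment_generating :: "real measure \<Rightarrow> real \<Rightarrow> ennreal" where
  "moment_generating \<mu> t = (\<integral>\<^sup>+ x. ennreal (exp (t * x)) \<partial>\<mu>)"

definition cramer_measures :: "real measure set" where
  "cramer_measures =
     {\<mu> \<in> borel_prob_measures. \<forall>\<^sub>F t in nhds 0. moment_generating \<mu> t < \<infinity>}"

lemma borel_prob_measures_convolution:
  assumes "\<mu> \<in> borel_prob_measures" "\<nu> \<in> borel_prob_measures"
  shows "(\<mu> \<star> \<nu>) \<in> borel_prob_measures"
proof -
  interpret M: prob_space \<mu> using assms by (simp add: borel_prob_measures_def)
  interpret N: prob_space \<nu> using assms by (simp add: borel_prob_measures_def)
  have [measurable_cong]: "sets \<mu> = sets borel" "sets \<nu> = sets borel"
    using assms by (simp_all add: borel_prob_measures_def)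
  interpret P: pair_prob_space \<mu> \<nu> ..
  have "prob_space (\<mu> \<star> \<nu>)"
    unfolding convolution_def by (rule P.prob_space_distr) measurable
  then show ?thesis by (simp add: borel_prob_measures_def)
qed

lemma convolution_subsemigroup_finite_moment_measures:
  assumes "p > 0"
  shows "convolution_subsemigroup (finite_moment_measures p)"
  unfolding convolution_subsemigroup_def
proof (intro conjI ballI)
  show "finite_moment_measures p \<subseteq> borel_prob_measures"
    by (auto simp: finite_moment_measures_def)
  fix \<mu> \<nu> assume *: "\<mu> \<in> finite_moment_measures p" "\<nu> \<in> finite_moment_measures p"
  then have B: "\<mu> \<in> borel_prob_measures" "\<nu> \<in> borel_prob_measures"
    by (simp_all add: finite_moment_measures_def)
  interpret M: prob_space \<mu> using B by (simp add: borel_prob_measures_def)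
  interpret N: prob_space \<nu> using B by (simp add: borel_prob_measures_def)
  have S [measurable_cong]: "sets \<mu> = sets borel" "sets \<nu> = sets borel"
    using B by (simp_all add: borel_prob_measures_def)
  have bound: "\<bar>x + y\<bar> powr p \<le> 2 powr p * (\<bar>x\<bar> powr p + \<bar>y\<bar> powr p)" for x y :: real
  proof -
    have "\<bar>x + y\<bar> powr p \<le> (2 * max \<bar>x\<bar> \<bar>y\<bar>) powr p"
      using assms by (intro powr_mono2) auto
    also have "\<dots> = 2 powr p * max \<bar>x\<bar> \<bar>y\<bar> powr p" by (simp add: powr_mult)
    also have "\<dots> \<le> 2 powr p * (\<bar>x\<bar> powr p + \<bar>y\<bar> powr p)"
      by (intro mult_left_mono) (auto simp: max_def)
    finally show ?thesis .
  qed
  have "(\<integral>\<^sup>+ z. ennreal (\<bar>z\<bar> powr p) \<partial>(\<mu> \<star> \<nu>))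
      = (\<integral>\<^sup>+ x. \<integral>\<^sup>+ y. ennreal (\<bar>x + y\<bar> powr p) \<partial>\<nu> \<partial>\<mu>)"
    by (intro nn_integral_convolution S M.finite_measure_axioms N.finite_measure_axioms) measurable
  also have "\<dots> \<le> (\<integral>\<^sup>+ x. \<integral>\<^sup>+ y. ennreal (2 powr p) * (ennreal (\<bar>x\<bar> powr p) + ennreal (\<bar>y\<bar> powr p)) \<partial>\<nu> \<partial>\<mu>)"
    by (intro nn_integral_mono)
       (use bound in \<open>simp add: ennreal_mult[symmetric] ennreal_plus[symmetric] del: ennreal_plus\<close>)
  also have "\<dots> = ennreal (2 powr p) * ((\<integral>\<^sup>+ x. ennreal (\<bar>x\<bar> powr p) \<partial>\<mu>) + (\<integral>\<^sup>+ y. ennreal (\<bar>y\<bar> powr p) \<partial>\<nu>))"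
    by (simp add: nn_integral_cmult nn_integral_add M.emeasure_space_1 N.emeasure_space_1)
  also have "\<dots> < \<infinity>"
    using * by (auto simp: finite_moment_measures_def ennreal_mult_less_top)
  finally show "(\<mu> \<star> \<nu>) \<in> finite_moment_measures p"
    using borel_prob_measures_convolution[OF B] by (simp add: finite_moment_measures_def)
qed

lemma moment_generating_convolution:
  assumes "\<mu> \<in> borel_prob_measures" "\<nu> \<in> borel_prob_measures"
  shows "moment_generating (\<mu> \<star> \<nu>) t = moment_generating \<mu> t * moment_generating \<nu> t"
proof -
  interpret M: prob_space \<mu> using assms by (simp add: borel_prob_measures_def)
  interpret N: prob_space \<nu> using assms by (simp add: borel_prob_measures_def)
  have S [measurable_cong]: "sets \<mu> = sets borel" "sets \<nu> = sets borel"
    using assms by (simp_all add: borel_prob_measures_def)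
  have "moment_generating (\<mu> \<star> \<nu>) t = (\<integral>\<^sup>+ x. \<integral>\<^sup>+ y. ennreal (exp (t * (x + y))) \<partial>\<nu> \<partial>\<mu>)"
    unfolding moment_generating_def
    by (intro nn_integral_convolution S M.finite_measure_axioms N.finite_measure_axioms) measurable
  also have "\<dots> = (\<integral>\<^sup>+ x. \<integral>\<^sup>+ y. ennreal (exp (t * x)) * ennreal (exp (t * y)) \<partial>\<nu> \<partial>\<mu>)"
    by (simp add: ring_distribs exp_add ennreal_mult)
  also have "\<dots> = moment_generating \<mu> t * moment_generating \<nu> t"
    by (simp add: nn_integral_cmult nn_integral_multc moment_generating_def)
  finally show ?thesis .
qed

lemma convolution_subsemigroup_cramer_measures: "convolution_subsemigroup cramer_measures"
  unfolding convolution_subsemigroup_def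
proof (intro conjI ballI)
  show "cramer_measures \<subseteq> borel_prob_measures"
    by (auto simp: cramer_measures_def)
  fix \<mu> \<nu> assume *: "\<mu> \<in> cramer_measures" "\<nu> \<in> cramer_measures"
  then have B: "\<mu> \<in> borel_prob_measures" "\<nu> \<in> borel_prob_measures"
    by (simp_all add: cramer_measures_def)
  have "\<forall>\<^sub>F t in nhds 0. moment_generating \<mu> t < \<infinity>" "\<forall>\<^sub>F t in nhds 0. moment_generating \<nu> t < \<infinity>"
    using * by (simp_all add: cramer_measures_def)
  then have "\<forall>\<^sub>F t in nhds 0. moment_generating (\<mu> \<star> \<nu>) t < \<infinity>"
    by eventually_elim (simp add: moment_generating_convolution[OF B] ennreal_mult_less_top)
  then show "(\<mu> \<star> \<nu>) \<in> cramer_measures"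
    using borel_prob_measures_convolution[OF B] by (simp add: cramer_measures_def)
qed

end

theory Submission
  imports Defs
begin

text \<open>The two families of semigroups share three features: they contain every distribution with some
finite exponential moment, every member has a mean, and membership is certified by integrability
of a weight \<open>w \<ge> 1\<close> with \<open>w (x + y) \<le> w x * w y\<close>. The locale \<open>weighted_semigroup\<close> records them,
and the classification is proved there from two comparison principles.

\<^item> If \<open>cdf \<nu> \<le> cdf \<mu>\<close> outside a bounded interval and \<open>\<mu>\<close> has the strictly
  smaller mean, then \<open>\<phi> \<mu> \<le> \<phi> \<nu>\<close>. The function \<open>cdf \<mu> - cdf \<nu>\<close> has positive integral and is
  nonnegative outside a bounded set, so averaging it against a Laplace kernel of very small rate makes
  it nonnegative everywhere: adding independent Laplace noise turns the comparison of tails and means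
  into stochastic order. The noise contributes the same amount to both sides and cancels.

\<^item> Some single \<open>\<nu>\<close> in the semigroup, concentrated on the nonnegative half-line, has an upper tail
  that eventually exceeds those of all convolution powers of \<open>\<mu>\<close>: far enough out, the tails of countably
  many distributions carry so little weight that they can be summed into one distribution.

Together they determine the sign of \<open>\<phi>\<close>. If \<open>\<mu>\<close> has negative mean, every positive power of \<open>\<mu>\<close> has
smaller mean than \<open>\<nu>\<close>, so \<open>n * \<phi> \<mu> \<le> \<phi> \<nu>\<close> for all \<open>n \<ge> 1\<close> and \<open>\<phi> \<mu> \<le> 0\<close>; the case of positive mean
is symmetric. Applying this to translates of the powers of \<open>\<mu>\<close> by integers pins \<open>\<phi> \<mu>\<close> down to \<open>c\<close>
times the mean, where \<open>c\<close> is the value of \<open>\<phi>\<close> at the unit mass at \<open>1\<close>.\<close>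

section \<open>Distribution functions and means\<close>

lemma borel_prob_measures_iff_real_distribution:
  "\<mu> \<in> borel_prob_measures \<longleftrightarrow> real_distribution \<mu>"
  by (auto simp: borel_prob_measures_def real_distribution_def real_distribution_axioms_def
      dest: sets_eq_imp_space_eq)

text \<open>For a point mass at \<open>a\<close> the integral is \<open>- a\<close>, and the general case averages over \<open>a\<close>. Subtracting
the step function, which is the distribution function of the unit mass at \<open>0\<close>, is what makes a
distribution function integrable.\<close>

lemma
  assumes "real_distribution \<mu>" "integrable \<mu> (\<lambda>x. x)"
  shows integrable_cdf_minus_step: "integrable lborel (\<lambda>x. cdf \<mu> x - indicator {0..} x)"
    and integral_cdf_minus_step: "(\<integral>x. cdf \<mu> x - indicator {0..} x \<partial>lborel) = - (\<integral>x. x \<partial>\<mu>)"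
proof -
  interpret real_distribution \<mu> by fact
  interpret P: pair_sigma_finite \<mu> lborel ..
  have [measurable_cong]: "sets \<mu> = sets borel" by simp
  let ?f = "\<lambda>a x::real. indicator {a..} x - indicator {0..} x :: real"
  have eq: "?f a = (if 0 \<le> a then (\<lambda>x. - indicator {0..<a} x) else indicator {a..<0})" for a
    by (auto simp: fun_eq_iff split: split_indicator)
  have int_f: "integrable lborel (?f a)" for a
    unfolding eq by simp
  have norm_f: "(\<integral>x. \<bar>?f a x\<bar> \<partial>lborel) = \<bar>a\<bar>" for a
    using fun_cong[OF eq[of a]] by (cases "0 \<le> a") simp_all
  have val_f: "(\<integral>x. ?f a x \<partial>lborel) = - a" for a
    unfolding eq by simp
  have f_eq: "?f a x = (if a \<le> x then 1 else 0) - (if 0 \<le> x then 1 else 0)" for a x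
    by (simp split: split_indicator)
  have F: "integrable (\<mu> \<Otimes>\<^sub>M lborel) (case_prod ?f)"
  proof (rule P.Fubini_integrable)
    show "case_prod ?f \<in> borel_measurable (\<mu> \<Otimes>\<^sub>M lborel)"
      unfolding f_eq by measurable
  qed (use assms int_f in \<open>simp_all add: norm_f\<close>)
  have fst: "(\<integral>a. ?f a x \<partial>\<mu>) = cdf \<mu> x - indicator {0..} x" for x
  proof -
    have "(\<integral>a. ?f a x \<partial>\<mu>) = (\<integral>a. indicator {..x} a - indicator {0..} x \<partial>\<mu>)"
      by (intro Bochner_Integration.integral_cong) (auto split: split_indicator)
    also have "\<dots> = cdf \<mu> x - indicator {0..} x"
      by (subst Bochner_Integration.integral_diff) (auto simp: cdf_def prob_space[simplified] emeasure_eq_measure integrable_indicator_iff)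
    finally show ?thesis .
  qed
  show "integrable lborel (\<lambda>x. cdf \<mu> x - indicator {0..} x)"
    using P.integrable_snd[OF F] by (simp add: fst)
  show "(\<integral>x. cdf \<mu> x - indicator {0..} x \<partial>lborel) = - (\<integral>x. x \<partial>\<mu>)"
    using P.Fubini_integral[OF F] by (simp only: fst val_f) simp
qed

lemma
  assumes "real_distribution \<mu>" "integrable \<mu> (\<lambda>x. x)" "real_distribution \<nu>" "integrable \<nu> (\<lambda>x. x)"
  shows integrable_cdf_diff: "integrable lborel (\<lambda>x. cdf \<mu> x - cdf \<nu> x)"
    and integral_cdf_diff: "(\<integral>x. cdf \<mu> x - cdf \<nu> x \<partial>lborel) = (\<integral>x. x \<partial>\<nu>) - (\<integral>x. x \<partial>\<mu>)"
proof -
  note * = integrable_cdf_minus_step[OF assms(1,2)] integrable_cdf_minus_step[OF assms(3,4)]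
  show "integrable lborel (\<lambda>x. cdf \<mu> x - cdf \<nu> x)"
    using Bochner_Integration.integrable_diff[OF *] by simp
  show "(\<integral>x. cdf \<mu> x - cdf \<nu> x \<partial>lborel) = (\<integral>x. x \<partial>\<nu>) - (\<integral>x. x \<partial>\<mu>)"
    using Bochner_Integration.integral_diff[OF *] assms by (simp add: integral_cdf_minus_step)
qed

lemma mean_mono_stoch_le:
  assumes "real_distribution \<mu>" "integrable \<mu> (\<lambda>x. x)" "real_distribution \<nu>" "integrable \<nu> (\<lambda>x. x)"
    and "stoch_le \<mu> \<nu>"
  shows "(\<integral>x. x \<partial>\<mu>) \<le> (\<integral>x. x \<partial>\<nu>)"
proof -
  have "0 \<le> (\<integral>x. cdf \<mu> x - cdf \<nu> x \<partial>lborel)"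
    using assms(5) by (intro Bochner_Integration.integral_nonneg) (simp add: stoch_le_def)
  then show ?thesis using integral_cdf_diff[OF assms(1-4)] by simp
qed

section \<open>Laplace smoothing\<close>

text \<open>As the rate of the kernel tends to \<open>0\<close>, the kernel centred at \<open>z\<close>, rescaled to have value \<open>1\<close> at the
origin, tends to \<open>1\<close> uniformly in \<open>z\<close> on bounded sets, so the smoothed function inherits the sign of the
integral. The uniformity comes from the triangle inequality, which bounds the rescaled kernel from
both sides by functions not depending on \<open>z\<close>; far out, where the kernel is not close to \<open>1\<close>, only
its positivity matters.\<close>

lemma exponential_kernel_nonneg:
  fixes g :: "real \<Rightarrow> real"
  assumes int: "integrable lborel g" and pos: "(\<integral>x. g x \<partial>lborel) > 0"
    and ev: "\<And>x. \<bar>x\<bar> \<ge> M \<Longrightarrow> g x \<ge> 0"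
  shows "\<exists>\<theta>>0. \<forall>z. 0 \<le> (\<integral>x. g x * exp (- \<theta> * \<bar>z - x\<bar>) \<partial>lborel)"
proof -
  have [measurable]: "g \<in> borel_measurable borel" using int by auto
  define r where "r n = 1 / real (Suc n)" for n
  \<comment> \<open>Lower bound, uniform in \<open>z\<close>, for \<open>g\<close> times the kernel rescaled by \<open>exp (r n * \<bar>z\<bar>)\<close>.\<close>
  define u where "u n x = g x * (if g x \<ge> 0 then exp (- r n * \<bar>x\<bar>) else exp (r n * \<bar>x\<bar>))" for n x
  have r: "0 < r n" "r n \<le> 1" for n by (auto simp: r_def)
  have r0: "r \<longlonglongrightarrow> 0" unfolding r_def
    by (rule LIMSEQ_Suc[OF lim_1_over_n])
  have [measurable]: "u n \<in> borel_measurable lborel" for n unfolding u_def by measurable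
  have bnd: "norm (u n x) \<le> \<bar>g x\<bar> * exp \<bar>M\<bar>" for n x
  proof (cases "g x \<ge> 0")
    case True
    have "- r n * \<bar>x\<bar> \<le> \<bar>M\<bar>" using r[of n] by (smt (verit) mult_nonneg_nonneg mult_minus_left)
    then show ?thesis using True by (simp add: u_def abs_mult mult_left_mono)
  next
    case False
    then have "\<bar>x\<bar> \<le> \<bar>M\<bar>" using ev[of x] by linarith
    then have "r n * \<bar>x\<bar> \<le> \<bar>M\<bar>" using r[of n] mult_left_le_one_le[of "\<bar>x\<bar>" "r n"] by simp
    then show ?thesis using False by (simp add: u_def abs_mult mult_left_mono)
  qed
  have lim: "(\<lambda>n. u n x) \<longlonglongrightarrow> g x" for x
  proof (cases "g x \<ge> 0")
    case True
    have "(\<lambda>n. g x * exp (- r n * \<bar>x\<bar>)) \<longlonglongrightarrow> g x * exp (- 0 * \<bar>x\<bar>)"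
      by (intro tendsto_intros r0)
    then show ?thesis using True by (simp add: u_def)
  next
    case False
    have "(\<lambda>n. g x * exp (r n * \<bar>x\<bar>)) \<longlonglongrightarrow> g x * exp (0 * \<bar>x\<bar>)"
      by (intro tendsto_intros r0)
    then show ?thesis using False by (simp add: u_def)
  qed
  have w: "integrable lborel (\<lambda>x. \<bar>g x\<bar> * exp \<bar>M\<bar>)" using int by auto
  have int_u: "integrable lborel (u n)" for n
    by (rule Bochner_Integration.integrable_bound[OF w]) (use bnd in auto)
  have "(\<lambda>n. \<integral>x. u n x \<partial>lborel) \<longlonglongrightarrow> (\<integral>x. g x \<partial>lborel)"
    by (rule integral_dominated_convergence[OF _ _ w]) (use lim bnd in auto)
  then have "\<forall>\<^sub>F n in sequentially. (\<integral>x. u n x \<partial>lborel) > 0"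
    using pos by (rule order_tendstoD)
  then obtain n where n: "(\<integral>x. u n x \<partial>lborel) > 0"
    by (auto simp: eventually_sequentially)
  have "0 \<le> (\<integral>x. g x * exp (- r n * \<bar>z - x\<bar>) \<partial>lborel)" for z
  proof -
    have int_k: "integrable lborel (\<lambda>x. g x * exp (- r n * \<bar>z - x\<bar>))"
      by (rule Bochner_Integration.integrable_bound[OF int])
         (use r[of n] in \<open>auto simp: abs_mult intro!: mult_left_le\<close>)
    have le: "u n x * exp (- r n * \<bar>z\<bar>) \<le> g x * exp (- r n * \<bar>z - x\<bar>)" for x
    proof (cases "g x \<ge> 0")
      case True
      have "r n * \<bar>z - x\<bar> \<le> r n * (\<bar>x\<bar> + \<bar>z\<bar>)" using r[of n] by (intro mult_left_mono) auto
      then have "exp (- r n * \<bar>x\<bar>) * exp (- r n * \<bar>z\<bar>) \<le> exp (- r n * \<bar>z - x\<bar>)"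
        by (simp add: exp_add[symmetric] algebra_simps)
      then show ?thesis using True by (simp add: u_def mult.assoc mult_left_mono)
    next
      case False
      have "r n * \<bar>z\<bar> \<le> r n * (\<bar>x\<bar> + \<bar>z - x\<bar>)" using r[of n] by (intro mult_left_mono) auto
      then have "exp (- r n * \<bar>z - x\<bar>) \<le> exp (r n * \<bar>x\<bar>) * exp (- r n * \<bar>z\<bar>)"
        by (simp add: exp_add[symmetric] algebra_simps)
      then show ?thesis using False by (simp add: u_def mult.assoc mult_left_mono_neg)
    qed
    have "0 \<le> (\<integral>x. u n x \<partial>lborel) * exp (- r n * \<bar>z\<bar>)" using n by simp
    also have "\<dots> = (\<integral>x. u n x * exp (- r n * \<bar>z\<bar>) \<partial>lborel)" by simp
    also have "\<dots> \<le> (\<integral>x. g x * exp (- r n * \<bar>z - x\<bar>) \<partial>lborel)"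
      using int_u int_k le by (intro integral_mono) auto
    finally show ?thesis .
  qed
  then show ?thesis using r(1)[of n] by blast
qed

definition laplace_distribution :: "real \<Rightarrow> real measure" where
  "laplace_distribution \<theta> = density lborel (\<lambda>x. ennreal (\<theta> / 2 * exp (- \<theta> * \<bar>x\<bar>)))"

text \<open>The Laplace density is the average of an exponential density and its reflection, except at the
origin, where both contribute.\<close>

lemma nn_integral_laplace_density:
  assumes "\<theta> > 0"
  shows "(\<integral>\<^sup>+x. ennreal (\<theta> / 2 * exp (- \<theta> * \<bar>x\<bar>)) \<partial>lborel) = 1"
proof -
  let ?e = "exponential_density \<theta>"
  have e: "(\<integral>\<^sup>+x. ennreal (?e x) \<partial>lborel) = 1"
    using prob_space.emeasure_space_1[OF prob_space_exponential_density[OF assms]]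
    by (simp add: emeasure_density)
  then have e': "(\<integral>\<^sup>+x. ennreal (?e (- x)) \<partial>lborel) = 1"
    using nn_integral_real_affine[of "\<lambda>x. ennreal (?e x)" "-1" 0] by simp
  have "(\<integral>\<^sup>+x. ennreal (\<theta> / 2 * exp (- \<theta> * \<bar>x\<bar>)) \<partial>lborel)
      = (\<integral>\<^sup>+x. ennreal (1 / 2) * (ennreal (?e x) + ennreal (?e (- x))) \<partial>lborel)"
  proof (rule nn_integral_cong_AE)
    show "AE x in lborel. ennreal (\<theta> / 2 * exp (- \<theta> * \<bar>x\<bar>))
        = ennreal (1 / 2) * (ennreal (?e x) + ennreal (?e (- x)))"
      using AE_lborel_singleton[of 0]
    proof eventually_elim
      case (elim x)
      then have "\<theta> / 2 * exp (- \<theta> * \<bar>x\<bar>) = 1 / 2 * (?e x + ?e (- x))"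
        by (auto simp: exponential_density_def mult.commute)
      then show ?case
        using assms by (simp only: ennreal_mult' ennreal_plus erlang_density_nonneg zero_le_divide_1_iff
            zero_le_numeral less_imp_le)
    qed
  qed
  also have "\<dots> = ennreal (1 / 2) * (1 + 1)"
    by (simp add: nn_integral_cmult nn_integral_add e e')
  also have "\<dots> = ennreal (1 / 2) * ennreal 2" by simp
  also have "\<dots> = ennreal (1 / 2 * 2)" by (rule ennreal_mult[symmetric]) simp_all
  also have "\<dots> = 1" by simp
  finally show ?thesis .
qed

lemma real_distribution_laplace:
  assumes "\<theta> > 0"
  shows "real_distribution (laplace_distribution \<theta>)"
proof -
  interpret prob_space "laplace_distribution \<theta>"
    by rule (use nn_integral_laplace_density[OF assms] in \<open>simp add: laplace_distribution_def emeasure_density\<close>)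
  show ?thesis by unfold_locales (simp_all add: laplace_distribution_def)
qed

lemma laplace_exponential_moment:
  assumes "\<theta> > 0"
  shows "(\<integral>\<^sup>+x. ennreal (exp (\<theta> / 2 * \<bar>x\<bar>)) \<partial>laplace_distribution \<theta>) < \<infinity>"
proof -
  have "(\<integral>\<^sup>+x. ennreal (exp (\<theta> / 2 * \<bar>x\<bar>)) \<partial>laplace_distribution \<theta>)
     = (\<integral>\<^sup>+x. ennreal (\<theta> / 2 * exp (- \<theta> * \<bar>x\<bar>)) * ennreal (exp (\<theta> / 2 * \<bar>x\<bar>)) \<partial>lborel)"
    unfolding laplace_distribution_def by (subst nn_integral_density) auto
  also have "\<dots> = (\<integral>\<^sup>+x. 2 * ennreal ((\<theta> / 2) / 2 * exp (- (\<theta> / 2) * \<bar>x\<bar>)) \<partial>lborel)"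
    using assms
    by (intro nn_integral_cong)
       (simp add: ennreal_mult[symmetric] exp_add[symmetric] algebra_simps flip: ennreal_numeral)
  also have "\<dots> = 2"
    using nn_integral_laplace_density[of "\<theta> / 2"] assms by (simp add: nn_integral_cmult)
  finally show ?thesis by simp
qed

lemma cdf_laplace_convolution:
  assumes "real_distribution \<mu>" "\<theta> > 0"
  shows "integrable lborel (\<lambda>x. \<theta> / 2 * exp (- \<theta> * \<bar>z - x\<bar>) * cdf \<mu> x)" (is ?int)
    and "cdf (laplace_distribution \<theta> \<star> \<mu>) z
      = (\<integral>x. \<theta> / 2 * exp (- \<theta> * \<bar>z - x\<bar>) * cdf \<mu> x \<partial>lborel)" (is ?eq)
proof -
  interpret real_distribution \<mu> by fact
  interpret L: real_distribution "laplace_distribution \<theta>" by (rule real_distribution_laplace) fact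
  have [measurable]: "cdf \<mu> \<in> borel_measurable borel"
    by (intro borel_measurable_mono monoI cdf_nondecreasing)
  have lap: "integrable lborel (\<lambda>x. \<theta> / 2 * exp (- \<theta> * \<bar>x\<bar>))"
    by (rule integrableI_nonneg) (use assms nn_integral_laplace_density[OF assms(2)] in auto)
  have lap_z: "integrable lborel (\<lambda>x. \<theta> / 2 * exp (- \<theta> * \<bar>z - x\<bar>))"
    using lborel_integrable_real_affine[OF lap, of "-1" z] by simp
  show ?int
    by (rule Bochner_Integration.integrable_bound[OF lap_z])
       (use assms cdf_nonneg cdf_bounded_prob in \<open>auto simp: abs_mult intro!: mult_left_le\<close>)
  have shift: "emeasure \<mu> {a. a + x \<le> z} = ennreal (cdf \<mu> (z - x))" for x
  proof -
    have "{a. a + x \<le> z} = {..z - x}" by auto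
    then show ?thesis by (simp add: emeasure_eq_measure cdf_def)
  qed
  have int2: "integrable lborel (\<lambda>x. \<theta> / 2 * exp (- \<theta> * \<bar>x\<bar>) * cdf \<mu> (z - x))"
    using lborel_integrable_real_affine[OF \<open>?int\<close>, of "-1" z] by simp
  have "emeasure (laplace_distribution \<theta> \<star> \<mu>) {..z} = (\<integral>\<^sup>+x. ennreal (cdf \<mu> (z - x)) \<partial>laplace_distribution \<theta>)"
    by (subst convolution_emeasure)
       (auto simp: shift finite_measure_axioms L.finite_measure_axioms)
  also have "\<dots> = (\<integral>\<^sup>+x. ennreal (\<theta> / 2 * exp (- \<theta> * \<bar>x\<bar>) * cdf \<mu> (z - x)) \<partial>lborel)"
    unfolding laplace_distribution_def using assms
    by (subst nn_integral_density)
       (auto intro!: nn_integral_cong simp: ennreal_mult[symmetric] cdf_nonneg)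
  also have "\<dots> = ennreal (\<integral>x. \<theta> / 2 * exp (- \<theta> * \<bar>x\<bar>) * cdf \<mu> (z - x) \<partial>lborel)"
    using assms by (intro nn_integral_eq_integral int2) (auto simp: cdf_nonneg)
  also have "(\<integral>x. \<theta> / 2 * exp (- \<theta> * \<bar>x\<bar>) * cdf \<mu> (z - x) \<partial>lborel)
      = (\<integral>x. \<theta> / 2 * exp (- \<theta> * \<bar>z - x\<bar>) * cdf \<mu> x \<partial>lborel)"
    using lborel_integral_real_affine[of "-1" "\<lambda>x. \<theta> / 2 * exp (- \<theta> * \<bar>z - x\<bar>) * cdf \<mu> x" z]
    by simp
  finally show ?eq
    using assms by (simp add: cdf_def measure_def integral_nonneg_AE)
qed

text \<open>This is where the means enter: the difference of the distribution functions integrates to the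
difference of the means, so strictness of the inequality is what the smoothing needs.\<close>

lemma stoch_le_laplace_convolution:
  assumes "real_distribution \<mu>" "integrable \<mu> (\<lambda>x. x)" "real_distribution \<nu>" "integrable \<nu> (\<lambda>x. x)"
    and mean: "(\<integral>x. x \<partial>\<mu>) < (\<integral>x. x \<partial>\<nu>)"
    and tails: "\<And>x. \<bar>x\<bar> \<ge> M \<Longrightarrow> cdf \<nu> x \<le> cdf \<mu> x"
  shows "\<exists>\<theta>>0. stoch_le (laplace_distribution \<theta> \<star> \<mu>) (laplace_distribution \<theta> \<star> \<nu>)"
proof -
  obtain \<theta> :: real where \<theta>: "\<theta> > 0"
    and nonneg: "\<And>z. 0 \<le> (\<integral>x. (cdf \<mu> x - cdf \<nu> x) * exp (- \<theta> * \<bar>z - x\<bar>) \<partial>lborel)"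
    using exponential_kernel_nonneg[OF integrable_cdf_diff[OF assms(1-4)], of M] mean tails
    by (auto simp: integral_cdf_diff[OF assms(1-4)])
  have "cdf (laplace_distribution \<theta> \<star> \<nu>) z \<le> cdf (laplace_distribution \<theta> \<star> \<mu>) z" for z
  proof -
    note c\<mu> = cdf_laplace_convolution[OF assms(1) \<theta>, of z] and c\<nu> = cdf_laplace_convolution[OF assms(3) \<theta>, of z]
    have "cdf (laplace_distribution \<theta> \<star> \<mu>) z - cdf (laplace_distribution \<theta> \<star> \<nu>) z
        = (\<integral>x. \<theta> / 2 * ((cdf \<mu> x - cdf \<nu> x) * exp (- \<theta> * \<bar>z - x\<bar>)) \<partial>lborel)"
      unfolding c\<mu>(2) c\<nu>(2) Bochner_Integration.integral_diff[OF c\<mu>(1) c\<nu>(1), symmetric]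
      by (simp add: algebra_simps)
    also have "\<dots> \<ge> 0" using nonneg[of z] \<theta> by simp
    finally show ?thesis by simp
  qed
  then show ?thesis using \<theta> by (auto simp: stoch_le_def)
qed

section \<open>Dominating the tails of countably many distributions\<close>

lemma suminf_ennreal_split_head: "(\<Sum>n. f n) = f 0 + (\<Sum>n. f (Suc n))" for f :: "nat \<Rightarrow> ennreal"
  using sums_unique[OF sums_Suc[OF summable_sums[OF summableI[of "\<lambda>n. f (Suc n)"]]]]
  by (simp add: add.commute)

lemma weighted_tail_small:
  assumes "real_distribution \<mu>" and [measurable]: "w \<in> borel_measurable borel"
    and fin: "(\<integral>\<^sup>+x. ennreal (w x) \<partial>\<mu>) < \<infinity>" and e: "0 < e"
  shows "\<exists>M. (\<integral>\<^sup>+x. indicator (- {- M..M}) x * ennreal (w x) \<partial>\<mu>) < e"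
proof -
  interpret real_distribution \<mu> by fact
  have [measurable]: "w \<in> borel_measurable \<mu>" by simp
  define \<rho> where "\<rho> = density \<mu> (\<lambda>x. ennreal (w x))"
  define T :: "nat \<Rightarrow> real set" where "T n = - {- real n..real n}" for n
  have sets_\<rho>: "sets \<rho> = sets borel" by (simp add: \<rho>_def)
  have em: "emeasure \<rho> (T n) = (\<integral>\<^sup>+x. indicator (T n) x * ennreal (w x) \<partial>\<mu>)" for n
    unfolding \<rho>_def by (subst emeasure_density) (auto simp: mult.commute T_def)
  have "emeasure \<rho> (T n) \<le> (\<integral>\<^sup>+x. ennreal (w x) \<partial>\<mu>)" for n
    unfolding em by (intro nn_integral_mono) (auto split: split_indicator)
  then have fin_T: "emeasure \<rho> (T n) \<noteq> \<infinity>" for n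
    using fin by (metis infinity_ennreal_def leD)
  have "(\<lambda>n. emeasure \<rho> (T n)) \<longlonglongrightarrow> emeasure \<rho> (\<Inter>n. T n)"
    using fin_T by (intro Lim_emeasure_decseq) (auto simp: decseq_def T_def sets_\<rho>)
  moreover have "(\<Inter>n. T n) = {}"
  proof -
    have "\<exists>n. \<bar>x\<bar> \<le> real n" for x using real_arch_simple by blast
    then show ?thesis by (auto simp: T_def) (metis abs_le_iff minus_le_iff)
  qed
  ultimately have "(\<lambda>n. emeasure \<rho> (T n)) \<longlonglongrightarrow> 0" by simp
  then have "\<forall>\<^sub>F n in sequentially. emeasure \<rho> (T n) < e"
    using e by (rule order_tendstoD)
  then obtain n where "emeasure \<rho> (T n) < e" by (auto simp: eventually_sequentially)
  then show ?thesis using em[of n] by (auto simp: T_def)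
qed

text \<open>The dominating measure is the sum of the \<open>\<mu> n\<close> restricted to the far-out part of \<open>P\<close>, topped up to
total mass \<open>1\<close> by an atom at \<open>0\<close>. The cutoffs \<open>M n\<close> are chosen such that the \<open>n\<close>-th piece has weighted
mass below \<open>(1 / 2) ^ Suc n\<close>; as the weight is at least \<open>1\<close>, this bounds the total mass and the weighted
mass at once. Taking for \<open>P\<close> one of the open half-lines gives a bound for upper or lower tails.\<close>

lemma common_tail_bound:
  fixes \<mu> :: "nat \<Rightarrow> real measure" and w :: "real \<Rightarrow> real"
  assumes dist: "\<And>n. real_distribution (\<mu> n)"
    and w [measurable]: "w \<in> borel_measurable borel" and w1: "\<And>x. 1 \<le> w x"
    and fin: "\<And>n. (\<integral>\<^sup>+x. ennreal (w x) \<partial>\<mu> n) < \<infinity>"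
    and P [measurable]: "P \<in> sets borel"
  shows "\<exists>\<nu>. real_distribution \<nu> \<and> (\<integral>\<^sup>+x. ennreal (w x) \<partial>\<nu>) < \<infinity> \<and>
    measure \<nu> (- insert 0 P) = 0 \<and>
    (\<forall>n. \<exists>M. \<forall>A\<in>sets borel. A \<subseteq> P - {- M..M} \<longrightarrow> measure (\<mu> n) A \<le> measure \<nu> A)"
proof -
  have [simp]: "sets (\<mu> n) = sets borel" "space (\<mu> n) = UNIV" for n
    using real_distribution.events_eq_borel[OF dist] real_distribution.space_eq_univ[OF dist] by auto
  have [measurable_cong]: "sets (\<mu> n) = sets borel" for n by simp
  have "\<exists>M. (\<integral>\<^sup>+x. indicator (- {- M..M}) x * ennreal (w x) \<partial>\<mu> n) < ennreal ((1 / 2) ^ Suc n)" for n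
    by (rule weighted_tail_small[OF dist w fin]) simp
  then obtain M where
    M: "\<And>n. (\<integral>\<^sup>+x. indicator (- {- M n..M n}) x * ennreal (w x) \<partial>\<mu> n) < ennreal ((1 / 2) ^ Suc n)"
    by metis
  define A where "A n = P - {- M n..M n}" for n
  have [measurable]: "A n \<in> sets borel" for n by (simp add: A_def)
  have weight_A: "(\<integral>\<^sup>+x. indicator (A n) x * ennreal (w x) \<partial>\<mu> n) \<le> ennreal ((1 / 2) ^ Suc n)" for n
    by (rule order_trans[OF nn_integral_mono less_imp_le[OF M[of n]]])
       (auto simp: A_def split: split_indicator)
  have "(\<Sum>n. \<integral>\<^sup>+x. indicator (A n) x * ennreal (w x) \<partial>\<mu> n) \<le> (\<Sum>n. ennreal ((1 / 2) ^ Suc n))"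
    by (intro suminf_le weight_A summableI)
  also have "\<dots> = ennreal 1"
    by (intro suminf_ennreal_eq power_half_series) simp
  finally have total_weight: "(\<Sum>n. \<integral>\<^sup>+x. indicator (A n) x * ennreal (w x) \<partial>\<mu> n) \<le> 1" by simp
  define m where "m = (\<Sum>n. emeasure (\<mu> n) (A n))"
  have "emeasure (\<mu> n) (A n) \<le> (\<integral>\<^sup>+x. indicator (A n) x * ennreal (w x) \<partial>\<mu> n)" for n
  proof -
    have "emeasure (\<mu> n) (A n) = (\<integral>\<^sup>+x. indicator (A n) x \<partial>\<mu> n)" by simp
    also have "\<dots> \<le> (\<integral>\<^sup>+x. indicator (A n) x * ennreal (w x) \<partial>\<mu> n)"
      using w1 by (intro nn_integral_mono) (auto split: split_indicator)
    finally show ?thesis .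
  qed
  then have "m \<le> 1"
    unfolding m_def by (intro order_trans[OF suminf_le total_weight] summableI)
  \<comment> \<open>Binding over the counting measure adds up the measures \<open>K k\<close>; index \<open>0\<close> is the atom.\<close>
  define K where "K k = (case k of 0 \<Rightarrow> density (return borel 0) (\<lambda>_. 1 - m)
      | Suc n \<Rightarrow> density (\<mu> n) (indicator (A n)))" for k
  define \<nu> where "\<nu> = count_space UNIV \<bind> K"
  have sets_K: "sets (K k) = sets borel" for k by (simp add: K_def split: nat.split)
  have space_K [simp]: "space (K k) = UNIV" for k
    using sets_eq_imp_space_eq[OF sets_K[of k]] by simp
  have K_0: "emeasure (K 0) B = (1 - m) * indicator B 0" if "B \<in> sets borel" for B
    using that by (simp add: K_def emeasure_density_const)
  have K_Suc: "emeasure (K (Suc n)) B = emeasure (\<mu> n) (A n \<inter> B)" if "B \<in> sets borel" for B n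
    using that by (simp add: K_def emeasure_density indicator_inter_arith[symmetric])
  have sub_K: "subprob_space (K k)" for k
  proof
    show "space (K k) \<noteq> {}" by simp
    show "emeasure (K k) (space (K k)) \<le> 1"
    proof (cases k)
      case 0
      then show ?thesis by (simp add: K_0 diff_le_self_ennreal)
    next
      case (Suc n)
      interpret D: real_distribution "\<mu> n" by (rule dist)
      show ?thesis using Suc by (simp add: K_Suc D.emeasure_le_1)
    qed
  qed
  have K_meas: "K \<in> count_space UNIV \<rightarrow>\<^sub>M subprob_algebra borel"
    by (rule measurable_subprob_algebra) (use sub_K sets_K in auto)
  have sets_\<nu>: "sets \<nu> = sets borel"
    unfolding \<nu>_def by (rule sets_bind) (use sets_K in auto)
  have em_\<nu>: "emeasure \<nu> B = (1 - m) * indicator B 0 + (\<Sum>n. emeasure (\<mu> n) (A n \<inter> B))"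
    if "B \<in> sets borel" for B
    unfolding \<nu>_def using that
    by (simp add: emeasure_bind[OF _ K_meas] nn_integral_count_space_nat K_0 K_Suc
        suminf_ennreal_split_head[of "\<lambda>k. emeasure (K k) B"])
  have prob_\<nu>: "prob_space \<nu>"
    by (rule prob_spaceI)
       (use \<open>m \<le> 1\<close> in \<open>simp add: sets_eq_imp_space_eq[OF sets_\<nu>] em_\<nu> diff_add_cancel_ennreal flip: m_def\<close>)
  then interpret N: prob_space \<nu> .
  have "real_distribution \<nu>"
    by unfold_locales (use sets_\<nu> in auto)
  moreover have "(\<integral>\<^sup>+x. ennreal (w x) \<partial>\<nu>) < \<infinity>"
  proof -
    have "(\<integral>\<^sup>+x. ennreal (w x) \<partial>\<nu>) = (\<Sum>k. \<integral>\<^sup>+x. ennreal (w x) \<partial>K k)"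
      unfolding \<nu>_def by (subst nn_integral_bind[OF _ K_meas]) (auto simp: nn_integral_count_space_nat)
    also have "\<dots> = (\<integral>\<^sup>+x. ennreal (w x) \<partial>K 0) + (\<Sum>n. \<integral>\<^sup>+x. indicator (A n) x * ennreal (w x) \<partial>\<mu> n)"
      by (subst suminf_ennreal_split_head) (simp add: K_def nn_integral_density)
    also have "(\<integral>\<^sup>+x. ennreal (w x) \<partial>K 0) = (1 - m) * ennreal (w 0)"
      by (simp add: K_def nn_integral_density nn_integral_return)
    also have "(1 - m) * ennreal (w 0) + (\<Sum>n. \<integral>\<^sup>+x. indicator (A n) x * ennreal (w x) \<partial>\<mu> n)
        \<le> 1 * ennreal (w 0) + 1"
      by (intro add_mono mult_right_mono total_weight) auto
    also have "\<dots> < \<infinity>" by simp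
    finally show ?thesis .
  qed
  moreover have "measure \<nu> (- insert 0 P) = 0"
  proof -
    have "A n \<inter> - insert 0 P = {}" for n by (auto simp: A_def)
    then show ?thesis by (simp add: measure_def em_\<nu>)
  qed
  moreover have "measure (\<mu> n) B \<le> measure \<nu> B" if "B \<in> sets borel" "B \<subseteq> P - {- M n..M n}" for n B
  proof -
    interpret D: real_distribution "\<mu> n" by (rule dist)
    have "emeasure (\<mu> n) B = emeasure (\<mu> n) (A n \<inter> B)"
      using that(2) by (intro arg_cong2[where f = emeasure]) (auto simp: A_def)
    also have "\<dots> \<le> (\<Sum>n. emeasure (\<mu> n) (A n \<inter> B))"
      using sum_le_suminf[of "\<lambda>n. emeasure (\<mu> n) (A n \<inter> B)" "{n}"] by (simp add: summableI)
    also have "\<dots> \<le> emeasure \<nu> B" using that(1) by (simp add: em_\<nu>)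
    finally show ?thesis by (simp add: D.emeasure_eq_measure N.emeasure_eq_measure)
  qed
  ultimately show ?thesis by blast
qed

text \<open>The condition on \<open>\<bar>x\<bar>\<close> covers the lower tails as well, where the comparison holds because the
dominating distribution does not charge the negative half-line.\<close>

lemma upper_tail_bound:
  fixes \<mu> :: "nat \<Rightarrow> real measure" and w :: "real \<Rightarrow> real"
  assumes "\<And>n. real_distribution (\<mu> n)" "w \<in> borel_measurable borel" "\<And>x. 1 \<le> w x"
    and "\<And>n. (\<integral>\<^sup>+x. ennreal (w x) \<partial>\<mu> n) < \<infinity>"
  shows "\<exists>\<nu>. real_distribution \<nu> \<and> (\<integral>\<^sup>+x. ennreal (w x) \<partial>\<nu>) < \<infinity> \<and> (AE x in \<nu>. 0 \<le> x) \<and>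
    (\<forall>n. \<exists>M. \<forall>x. \<bar>x\<bar> \<ge> M \<longrightarrow> cdf \<nu> x \<le> cdf (\<mu> n) x)"
proof -
  obtain \<nu> where \<nu>: "real_distribution \<nu>" "(\<integral>\<^sup>+x. ennreal (w x) \<partial>\<nu>) < \<infinity>"
    and null: "measure \<nu> (- insert 0 {0<..}) = 0"
    and tail: "\<And>n. \<exists>M. \<forall>A\<in>sets borel. A \<subseteq> {0<..} - {- M..M} \<longrightarrow> measure (\<mu> n) A \<le> measure \<nu> A"
    using common_tail_bound[where \<mu> = \<mu> and P = "{0<..}", OF assms] by auto
  interpret N: real_distribution \<nu> by fact
  have "- insert 0 {0<..} = {..<0::real}" by auto
  then have neg: "measure \<nu> {..<0} = 0" using null by simp
  have "AE x in \<nu>. 0 \<le> x"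
    by (rule AE_I[of _ _ "{..<0}"]) (auto simp: neg N.emeasure_eq_measure)
  moreover have "\<exists>M. \<forall>x. \<bar>x\<bar> \<ge> M \<longrightarrow> cdf \<nu> x \<le> cdf (\<mu> n) x" for n
  proof -
    interpret D: real_distribution "\<mu> n" by (rule assms)
    obtain M where M: "\<And>A. A \<in> sets borel \<Longrightarrow> A \<subseteq> {0<..} - {- M..M} \<Longrightarrow> measure (\<mu> n) A \<le> measure \<nu> A"
      using tail by blast
    have "cdf \<nu> x \<le> cdf (\<mu> n) x" if "\<bar>x\<bar> \<ge> M" for x
    proof (cases "x < 0")
      case True
      then have "cdf \<nu> x \<le> measure \<nu> {..<0}"
        unfolding cdf_def by (intro N.finite_measure_mono) auto
      then show ?thesis using neg D.cdf_nonneg[of x] by simp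
    next
      case False
      have compl: "UNIV - {..x} = {x<..}" by auto
      have "measure (\<mu> n) {x<..} \<le> measure \<nu> {x<..}"
        using that False by (intro M) auto
      then show ?thesis
        using N.prob_compl[of "{..x}"] D.prob_compl[of "{..x}"] by (simp add: cdf_def compl)
    qed
    then show ?thesis by blast
  qed
  ultimately show ?thesis using \<nu> by blast
qed

lemma lower_tail_bound:
  fixes \<mu> :: "nat \<Rightarrow> real measure" and w :: "real \<Rightarrow> real"
  assumes "\<And>n. real_distribution (\<mu> n)" "w \<in> borel_measurable borel" "\<And>x. 1 \<le> w x"
    and "\<And>n. (\<integral>\<^sup>+x. ennreal (w x) \<partial>\<mu> n) < \<infinity>"
  shows "\<exists>\<nu>. real_distribution \<nu> \<and> (\<integral>\<^sup>+x. ennreal (w x) \<partial>\<nu>) < \<infinity> \<and> (AE x in \<nu>. x \<le> 0) \<and>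
    (\<forall>n. \<exists>M. \<forall>x. \<bar>x\<bar> \<ge> M \<longrightarrow> cdf (\<mu> n) x \<le> cdf \<nu> x)"
proof -
  obtain \<nu> where \<nu>: "real_distribution \<nu>" "(\<integral>\<^sup>+x. ennreal (w x) \<partial>\<nu>) < \<infinity>"
    and null: "measure \<nu> (- insert 0 {..<0}) = 0"
    and tail: "\<And>n. \<exists>M. \<forall>A\<in>sets borel. A \<subseteq> {..<0} - {- M..M} \<longrightarrow> measure (\<mu> n) A \<le> measure \<nu> A"
    using common_tail_bound[where \<mu> = \<mu> and P = "{..<0}", OF assms] by auto
  interpret N: real_distribution \<nu> by fact
  have "- insert 0 {..<0} = {0::real<..}" by auto
  then have pos: "measure \<nu> {0<..} = 0" using null by simp
  have "AE x in \<nu>. x \<le> 0"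
    by (rule AE_I[of _ _ "{0<..}"]) (auto simp: pos N.emeasure_eq_measure)
  moreover have "\<exists>M. \<forall>x. \<bar>x\<bar> \<ge> M \<longrightarrow> cdf (\<mu> n) x \<le> cdf \<nu> x" for n
  proof -
    interpret D: real_distribution "\<mu> n" by (rule assms)
    obtain M where M: "\<And>A. A \<in> sets borel \<Longrightarrow> A \<subseteq> {..<0} - {- M..M} \<Longrightarrow> measure (\<mu> n) A \<le> measure \<nu> A"
      using tail by blast
    \<comment> \<open>The summand \<open>1\<close> is needed because the closed half-line must miss \<open>- M\<close> itself.\<close>
    have "cdf (\<mu> n) x \<le> cdf \<nu> x" if "\<bar>x\<bar> \<ge> \<bar>M\<bar> + 1" for x
    proof (cases "x < 0")
      case True
      then show ?thesis
        unfolding cdf_def using that by (intro M) auto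
    next
      case False
      have "UNIV - {..x} = {x<..}" by auto
      moreover have "measure \<nu> {x<..} \<le> measure \<nu> {0<..}"
        using False by (intro N.finite_measure_mono) auto
      ultimately have "cdf \<nu> x \<ge> 1"
        using N.prob_compl[of "{..x}"] pos by (simp add: cdf_def)
      then show ?thesis using D.cdf_bounded_prob[of x] by simp
    qed
    then show ?thesis by blast
  qed
  ultimately show ?thesis using \<nu> by blast
qed

section \<open>Convolution powers and their moments\<close>

lemma mean_convolution:
  assumes "real_distribution \<mu>" "integrable \<mu> (\<lambda>x. x)" "real_distribution \<nu>" "integrable \<nu> (\<lambda>x. x)"
  shows "(\<integral>x. x \<partial>(\<mu> \<star> \<nu>)) = (\<integral>x. x \<partial>\<mu>) + (\<integral>x. x \<partial>\<nu>)"
proof -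
  interpret M: real_distribution \<mu> by fact
  interpret N: real_distribution \<nu> by fact
  interpret P: pair_sigma_finite \<mu> \<nu> ..
  have [measurable_cong]: "sets \<mu> = sets borel" "sets \<nu> = sets borel" by simp_all
  have fst: "integrable (\<mu> \<Otimes>\<^sub>M \<nu>) (\<lambda>z. fst z)"
    using assms(2) by (intro P.Fubini_integrable) auto
  have snd: "integrable (\<mu> \<Otimes>\<^sub>M \<nu>) (\<lambda>z. snd z)"
    using assms(4) by (intro P.Fubini_integrable) auto
  have "(\<integral>x. x \<partial>(\<mu> \<star> \<nu>)) = (\<integral>z. fst z + snd z \<partial>(\<mu> \<Otimes>\<^sub>M \<nu>))"
    unfolding convolution_def by (subst integral_distr) (auto simp: case_prod_beta')
  also have "\<dots> = (\<integral>x. \<integral>y. fst (x, y) + snd (x, y) \<partial>\<nu> \<partial>\<mu>)"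
    using fst snd by (intro P.integral_fst'[symmetric]) auto
  also have "\<dots> = (\<integral>x. x \<partial>\<mu>) + (\<integral>x. x \<partial>\<nu>)"
    using assms M.prob_space N.prob_space by simp
  finally show ?thesis .
qed

primrec convolution_power :: "real measure \<Rightarrow> nat \<Rightarrow> real measure" where
  "convolution_power \<mu> 0 = return borel 0"
| "convolution_power \<mu> (Suc n) = (\<mu> \<star> convolution_power \<mu> n)"

lemma real_distribution_return: "real_distribution (return borel t)"
proof -
  interpret prob_space "return borel t" by (rule prob_space_return) simp
  show ?thesis by unfold_locales simp_all
qed

lemma real_distribution_convolution:
  "real_distribution \<mu> \<Longrightarrow> real_distribution \<nu> \<Longrightarrow> real_distribution (\<mu> \<star> \<nu>)"
  by (simp add: borel_prob_measures_convolution flip: borel_prob_measures_iff_real_distribution)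

lemma real_distribution_convolution_power:
  "real_distribution \<mu> \<Longrightarrow> real_distribution (convolution_power \<mu> n)"
  by (induction n) (simp_all add: real_distribution_return real_distribution_convolution)

lemma convolution_return_return:
  "(return borel (s :: real) \<star> return borel t) = return borel (s + t)"
proof (rule measure_eqI)
  interpret S: real_distribution "return borel s" by (rule real_distribution_return)
  interpret T: real_distribution "return borel t" by (rule real_distribution_return)
  fix A assume "A \<in> sets (return borel s \<star> return borel t)"
  then have A [measurable]: "A \<in> sets borel" by simp
  show "emeasure (return borel s \<star> return borel t) A = emeasure (return borel (s + t)) A"
    by (subst convolution_emeasure')
       (auto simp: S.finite_measure_axioms T.finite_measure_axioms nn_integral_return)
qed simp

text \<open>Submultiplicativity ensures that one weight serves all convolution powers. This matters for the
Cramer class: a distribution dominating the tails of all powers of \<open>\<mu>\<close> must have some exponential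
moment itself, so the rates available for the powers must not shrink to \<open>0\<close>.\<close>

definition submultiplicative_weight :: "(real \<Rightarrow> real) \<Rightarrow> bool" where
  "submultiplicative_weight w \<longleftrightarrow>
     w \<in> borel_measurable borel \<and> (\<forall>x. 1 \<le> w x) \<and> (\<forall>x y. w (x + y) \<le> w x * w y)"

lemma weight_moment_convolution_power:
  assumes "submultiplicative_weight w" "real_distribution \<mu>" "(\<integral>\<^sup>+x. ennreal (w x) \<partial>\<mu>) < \<infinity>"
  shows "(\<integral>\<^sup>+x. ennreal (w x) \<partial>convolution_power \<mu> n) < \<infinity>"
proof (induction n)
  case 0
  then show ?case
    using assms(1) by (auto simp: submultiplicative_weight_def nn_integral_return[of 0 borel "\<lambda>x. ennreal (w x)"])
next
  case (Suc n)
  have w [measurable]: "w \<in> borel_measurable borel" and w1: "1 \<le> w x" and sub: "w (x + y) \<le> w x * w y" for x y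
    using assms(1) by (auto simp: submultiplicative_weight_def)
  have w0: "0 \<le> w x" for x using w1[of x] by linarith
  interpret M: real_distribution \<mu> by fact
  interpret N: real_distribution "convolution_power \<mu> n"
    by (rule real_distribution_convolution_power) fact
  have [measurable_cong]: "sets \<mu> = sets borel" "sets (convolution_power \<mu> n) = sets borel" by simp_all
  have "(\<integral>\<^sup>+x. ennreal (w x) \<partial>convolution_power \<mu> (Suc n))
      = (\<integral>\<^sup>+x. \<integral>\<^sup>+y. ennreal (w (x + y)) \<partial>convolution_power \<mu> n \<partial>\<mu>)"
    by (simp add: nn_integral_convolution M.finite_measure_axioms N.finite_measure_axioms)
  also have "\<dots> \<le> (\<integral>\<^sup>+x. \<integral>\<^sup>+y. ennreal (w x) * ennreal (w y) \<partial>convolution_power \<mu> n \<partial>\<mu>)"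
    using sub w0 by (intro nn_integral_mono) (auto simp: ennreal_mult[symmetric] ennreal_leI)
  also have "\<dots> = (\<integral>\<^sup>+x. ennreal (w x) \<partial>\<mu>) * (\<integral>\<^sup>+y. ennreal (w y) \<partial>convolution_power \<mu> n)"
    by (simp add: nn_integral_cmult nn_integral_multc)
  also have "\<dots> < \<infinity>"
    using assms(3) Suc by (simp add: ennreal_mult_less_top)
  finally show ?case .
qed

section \<open>Monotone additive statistics on weighted semigroups\<close>

lemma nonpos_of_multiples_bounded:
  fixes a b :: real
  assumes "\<And>n. real (Suc n) * a \<le> b"
  shows "a \<le> 0"
proof (rule ccontr)
  assume "\<not> a \<le> 0"
  then obtain n where "b < real n * a" using reals_Archimedean3[of a] by auto
  also have "\<dots> \<le> real (Suc n) * a" using \<open>\<not> a \<le> 0\<close> by (intro mult_right_mono) auto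
  finally show False using assms[of n] by simp
qed

text \<open>Exponential moments guarantee membership of the Laplace noise and of point masses; the weight,
which may depend on the member, guarantees membership of the dominating distributions.\<close>

locale weighted_semigroup =
  fixes S :: "real measure set"
  assumes subsemigroup: "convolution_subsemigroup S"
    and integrable_id: "\<mu> \<in> S \<Longrightarrow> integrable \<mu> (\<lambda>x. x)"
    and exponential_moment_mem: "real_distribution \<mu> \<Longrightarrow> a > 0 \<Longrightarrow>
      (\<integral>\<^sup>+x. ennreal (exp (a * \<bar>x\<bar>)) \<partial>\<mu>) < \<infinity> \<Longrightarrow> \<mu> \<in> S"
    and weight: "\<mu> \<in> S \<Longrightarrow> \<exists>w. submultiplicative_weight w \<and> (\<integral>\<^sup>+x. ennreal (w x) \<partial>\<mu>) < \<infinity> \<and>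
      (\<forall>\<nu>. real_distribution \<nu> \<longrightarrow> (\<integral>\<^sup>+x. ennreal (w x) \<partial>\<nu>) < \<infinity> \<longrightarrow> \<nu> \<in> S)"
begin

lemma real_distribution_mem: "\<mu> \<in> S \<Longrightarrow> real_distribution \<mu>"
  using subsemigroup borel_prob_measures_iff_real_distribution
  by (auto simp: convolution_subsemigroup_def)

lemma convolution_mem: "\<mu> \<in> S \<Longrightarrow> \<nu> \<in> S \<Longrightarrow> (\<mu> \<star> \<nu>) \<in> S"
  using subsemigroup by (auto simp: convolution_subsemigroup_def)

lemma return_mem: "return borel t \<in> S"
  by (rule exponential_moment_mem[OF real_distribution_return, of 1]) (simp_all add: nn_integral_return)

lemma laplace_mem: "\<theta> > 0 \<Longrightarrow> laplace_distribution \<theta> \<in> S"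
  using exponential_moment_mem[OF real_distribution_laplace, of \<theta> "\<theta> / 2"] laplace_exponential_moment
  by simp

lemma convolution_power_mem: "\<mu> \<in> S \<Longrightarrow> convolution_power \<mu> n \<in> S"
  by (induction n) (simp_all add: return_mem convolution_mem)

lemma mean_convolution_mem:
  "\<mu> \<in> S \<Longrightarrow> \<nu> \<in> S \<Longrightarrow> (\<integral>x. x \<partial>(\<mu> \<star> \<nu>)) = (\<integral>x. x \<partial>\<mu>) + (\<integral>x. x \<partial>\<nu>)"
  by (simp add: mean_convolution real_distribution_mem integrable_id)

lemma mean_convolution_power:
  "\<mu> \<in> S \<Longrightarrow> (\<integral>x. x \<partial>convolution_power \<mu> n) = real n * (\<integral>x. x \<partial>\<mu>)"
  by (induction n)
     (simp_all add: integral_return mean_convolution_mem convolution_power_mem algebra_simps)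

lemma mean_monotone_additive:
  assumes "c \<ge> 0" "\<And>\<mu>. \<mu> \<in> S \<Longrightarrow> \<phi> \<mu> = c * (\<integral>x. x \<partial>\<mu>)"
  shows "monotone_additive_statistic S \<phi>"
  unfolding monotone_additive_statistic_def additive_statistic_def
proof (intro conjI ballI monotone_onI)
  fix \<mu> \<nu> assume "\<mu> \<in> S" "\<nu> \<in> S"
  then show "\<phi> (\<mu> \<star> \<nu>) = \<phi> \<mu> + \<phi> \<nu>"
    by (simp add: assms(2) convolution_mem mean_convolution_mem algebra_simps)
next
  fix \<mu> \<nu> assume "\<mu> \<in> S" "\<nu> \<in> S" "stoch_le \<mu> \<nu>"
  then show "\<phi> \<mu> \<le> \<phi> \<nu>"
    using assms(1)
    by (simp add: assms(2) mean_mono_stoch_le real_distribution_mem integrable_id mult_left_mono)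
qed

context
  fixes \<phi> :: "real measure \<Rightarrow> real"
  assumes \<phi>: "monotone_additive_statistic S \<phi>"
begin

lemma additive: "\<mu> \<in> S \<Longrightarrow> \<nu> \<in> S \<Longrightarrow> \<phi> (\<mu> \<star> \<nu>) = \<phi> \<mu> + \<phi> \<nu>"
  using \<phi> by (simp add: monotone_additive_statistic_def additive_statistic_def)

lemma monotone: "\<mu> \<in> S \<Longrightarrow> \<nu> \<in> S \<Longrightarrow> stoch_le \<mu> \<nu> \<Longrightarrow> \<phi> \<mu> \<le> \<phi> \<nu>"
  using \<phi> by (auto simp: monotone_additive_statistic_def monotone_on_def)

lemma statistic_return_0: "\<phi> (return borel 0) = 0"
  using additive[OF return_mem return_mem, of 0 0] by (simp add: convolution_return_return)

lemma statistic_convolution_power: "\<mu> \<in> S \<Longrightarrow> \<phi> (convolution_power \<mu> n) = real n * \<phi> \<mu>"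
  by (induction n) (simp_all add: statistic_return_0 additive convolution_power_mem algebra_simps)

lemma statistic_return_of_int: "\<phi> (return borel (of_int k)) = of_int k * \<phi> (return borel 1)"
proof -
  have nat: "\<phi> (return borel (real n)) = real n * \<phi> (return borel 1)" for n
  proof (induction n)
    case (Suc n)
    then show ?case
      using additive[OF return_mem return_mem, of "real n" 1]
      by (simp add: convolution_return_return algebra_simps)
  qed (simp add: statistic_return_0)
  have neg: "\<phi> (return borel (- t)) = - \<phi> (return borel t)" for t
    using additive[OF return_mem return_mem, of t "- t"]
    by (simp add: convolution_return_return statistic_return_0)
  show ?thesis
    by (cases k rule: int_cases2) (simp_all add: nat neg)
qed

text \<open>Monotonicity is applied after adding Laplace noise, and additivity removes the noise again.\<close>

lemma statistic_le_of_tails: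
  assumes "\<mu> \<in> S" "\<nu> \<in> S" "(\<integral>x. x \<partial>\<mu>) < (\<integral>x. x \<partial>\<nu>)"
    and "\<And>x. \<bar>x\<bar> \<ge> M \<Longrightarrow> cdf \<nu> x \<le> cdf \<mu> x"
  shows "\<phi> \<mu> \<le> \<phi> \<nu>"
proof -
  obtain \<theta> :: real where "\<theta> > 0"
    and le: "stoch_le (laplace_distribution \<theta> \<star> \<mu>) (laplace_distribution \<theta> \<star> \<nu>)"
    using stoch_le_laplace_convolution[of \<mu> \<nu> M] assms by (auto simp: real_distribution_mem integrable_id)
  then have L: "laplace_distribution \<theta> \<in> S" by (simp add: laplace_mem)
  show ?thesis
    using monotone[OF convolution_mem convolution_mem le] L assms by (simp add: additive)
qed

text \<open>A single real number bounds all multiples of \<open>\<phi> \<mu>\<close>, because a single distribution dominates the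
tails of all powers of \<open>\<mu>\<close>. Negativity of the mean keeps the means of the powers below the mean of
that distribution, which lives on the nonnegative half-line.\<close>

lemma statistic_nonpos:
  assumes \<mu>: "\<mu> \<in> S" and neg: "(\<integral>x. x \<partial>\<mu>) < 0"
  shows "\<phi> \<mu> \<le> 0"
proof -
  obtain w where w: "submultiplicative_weight w" "(\<integral>\<^sup>+x. ennreal (w x) \<partial>\<mu>) < \<infinity>"
    and mem: "\<And>\<nu>. real_distribution \<nu> \<Longrightarrow> (\<integral>\<^sup>+x. ennreal (w x) \<partial>\<nu>) < \<infinity> \<Longrightarrow> \<nu> \<in> S"
    using weight[OF \<mu>] by auto
  have "\<exists>\<nu>. real_distribution \<nu> \<and> (\<integral>\<^sup>+x. ennreal (w x) \<partial>\<nu>) < \<infinity> \<and> (AE x in \<nu>. 0 \<le> x) \<and>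
      (\<forall>n. \<exists>M. \<forall>x. \<bar>x\<bar> \<ge> M \<longrightarrow> cdf \<nu> x \<le> cdf (convolution_power \<mu> n) x)"
    using w real_distribution_mem[OF \<mu>]
    by (intro upper_tail_bound real_distribution_convolution_power weight_moment_convolution_power)
       (auto simp: submultiplicative_weight_def)
  then obtain \<nu> where \<nu>: "\<nu> \<in> S" and "AE x in \<nu>. 0 \<le> x"
    and tails: "\<And>n. \<exists>M. \<forall>x. \<bar>x\<bar> \<ge> M \<longrightarrow> cdf \<nu> x \<le> cdf (convolution_power \<mu> n) x"
    using mem by auto
  then have mean: "0 \<le> (\<integral>x. x \<partial>\<nu>)" by (intro integral_nonneg_AE)
  have "real (Suc n) * \<phi> \<mu> \<le> \<phi> \<nu>" for n
  proof -
    obtain M where M: "\<And>x. \<bar>x\<bar> \<ge> M \<Longrightarrow> cdf \<nu> x \<le> cdf (convolution_power \<mu> (Suc n)) x"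
      using tails by blast
    have "real (Suc n) * (\<integral>x. x \<partial>\<mu>) < 0" using neg by (intro mult_pos_neg) auto
    then have "(\<integral>x. x \<partial>convolution_power \<mu> (Suc n)) < (\<integral>x. x \<partial>\<nu>)"
      using mean unfolding mean_convolution_power[OF \<mu>] by linarith
    then have "\<phi> (convolution_power \<mu> (Suc n)) \<le> \<phi> \<nu>"
      using M by (rule statistic_le_of_tails[OF convolution_power_mem[OF \<mu>] \<nu>])
    then show ?thesis unfolding statistic_convolution_power[OF \<mu>] .
  qed
  then show ?thesis by (rule nonpos_of_multiples_bounded)
qed

text \<open>Reflection exchanges this with the previous lemma, with lower tails in place of upper ones.\<close>

lemma statistic_nonneg:
  assumes \<mu>: "\<mu> \<in> S" and pos: "0 < (\<integral>x. x \<partial>\<mu>)"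
  shows "0 \<le> \<phi> \<mu>"
proof -
  obtain w where w: "submultiplicative_weight w" "(\<integral>\<^sup>+x. ennreal (w x) \<partial>\<mu>) < \<infinity>"
    and mem: "\<And>\<nu>. real_distribution \<nu> \<Longrightarrow> (\<integral>\<^sup>+x. ennreal (w x) \<partial>\<nu>) < \<infinity> \<Longrightarrow> \<nu> \<in> S"
    using weight[OF \<mu>] by auto
  have "\<exists>\<nu>. real_distribution \<nu> \<and> (\<integral>\<^sup>+x. ennreal (w x) \<partial>\<nu>) < \<infinity> \<and> (AE x in \<nu>. x \<le> 0) \<and>
      (\<forall>n. \<exists>M. \<forall>x. \<bar>x\<bar> \<ge> M \<longrightarrow> cdf (convolution_power \<mu> n) x \<le> cdf \<nu> x)"
    using w real_distribution_mem[OF \<mu>]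
    by (intro lower_tail_bound real_distribution_convolution_power weight_moment_convolution_power)
       (auto simp: submultiplicative_weight_def)
  then obtain \<nu> where \<nu>: "\<nu> \<in> S" and "AE x in \<nu>. x \<le> 0"
    and tails: "\<And>n. \<exists>M. \<forall>x. \<bar>x\<bar> \<ge> M \<longrightarrow> cdf (convolution_power \<mu> n) x \<le> cdf \<nu> x"
    using mem by auto
  then have "0 \<le> (\<integral>x. - x \<partial>\<nu>)" by (intro integral_nonneg_AE) auto
  then have mean: "(\<integral>x. x \<partial>\<nu>) \<le> 0" by simp
  have "real (Suc n) * (- \<phi> \<mu>) \<le> - \<phi> \<nu>" for n
  proof -
    obtain M where M: "\<And>x. \<bar>x\<bar> \<ge> M \<Longrightarrow> cdf (convolution_power \<mu> (Suc n)) x \<le> cdf \<nu> x"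
      using tails by blast
    have "0 < real (Suc n) * (\<integral>x. x \<partial>\<mu>)" using pos by (intro mult_pos_pos) auto
    then have "(\<integral>x. x \<partial>\<nu>) < (\<integral>x. x \<partial>convolution_power \<mu> (Suc n))"
      using mean unfolding mean_convolution_power[OF \<mu>] by linarith
    then have "\<phi> \<nu> \<le> \<phi> (convolution_power \<mu> (Suc n))"
      using M by (rule statistic_le_of_tails[OF \<nu> convolution_power_mem[OF \<mu>]])
    then show ?thesis unfolding statistic_convolution_power[OF \<mu>] by simp
  qed
  then have "- \<phi> \<mu> \<le> 0" by (rule nonpos_of_multiples_bounded)
  then show ?thesis by simp
qed

text \<open>Translating the \<open>n\<close>-th power of \<open>\<mu>\<close> by the integer that just makes its mean negative (or positive)
bounds \<open>n * (\<phi> \<mu> - c * m)\<close> above (or below) by a constant; the rounding error costs at most \<open>c\<close>.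
Only integer translations occur because at integer point masses additivity alone expresses \<open>\<phi>\<close> through \<open>c\<close>.\<close>

lemma statistic_eq_mean:
  assumes \<mu>: "\<mu> \<in> S"
  shows "\<phi> \<mu> = \<phi> (return borel 1) * (\<integral>x. x \<partial>\<mu>)"
proof -
  define c where "c = \<phi> (return borel 1)"
  define m where "m = (\<integral>x. x \<partial>\<mu>)"
  have shifted: "(\<integral>x. x \<partial>(convolution_power \<mu> n \<star> return borel (of_int k))) = real n * m + of_int k"
    "\<phi> (convolution_power \<mu> n \<star> return borel (of_int k)) = real n * \<phi> \<mu> + of_int k * c"
    "(convolution_power \<mu> n \<star> return borel (of_int k)) \<in> S" for n k
    using \<mu> by (simp_all add: mean_convolution_mem mean_convolution_power convolution_power_mem return_mem
      integral_return additive statistic_convolution_power statistic_return_of_int[of k] convolution_mem m_def c_def)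
  have c: "0 \<le> c"
    unfolding c_def by (rule statistic_nonneg[OF return_mem]) (simp add: integral_return)
  have "real (Suc n) * (\<phi> \<mu> - c * m) \<le> c" for n
  proof -
    define k where "k = \<lfloor>real (Suc n) * m\<rfloor> + 1"
    have k: "real (Suc n) * m < of_int k" "of_int k \<le> real (Suc n) * m + 1"
      unfolding k_def by linarith+
    have "real (Suc n) * \<phi> \<mu> + of_int (- k) * c \<le> 0"
      unfolding shifted(2)[symmetric] by (rule statistic_nonpos[OF shifted(3)]) (use k shifted(1)[of "Suc n" "- k"] in simp)
    also have "of_int k * c \<le> (real (Suc n) * m + 1) * c" using k c by (intro mult_right_mono)
    ultimately show ?thesis by (simp add: algebra_simps)
  qed
  then have le: "\<phi> \<mu> - c * m \<le> 0" by (rule nonpos_of_multiples_bounded)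
  have "real (Suc n) * (c * m - \<phi> \<mu>) \<le> c" for n
  proof -
    define k where "k = \<lceil>real (Suc n) * m\<rceil> - 1"
    have k: "of_int k < real (Suc n) * m" "real (Suc n) * m - 1 \<le> of_int k"
      unfolding k_def by linarith+
    have "0 \<le> real (Suc n) * \<phi> \<mu> + of_int (- k) * c"
      unfolding shifted(2)[symmetric] by (rule statistic_nonneg[OF shifted(3)]) (use k shifted(1)[of "Suc n" "- k"] in simp)
    moreover have "(real (Suc n) * m - 1) * c \<le> of_int k * c" using k c by (intro mult_right_mono)
    ultimately show ?thesis by (simp add: algebra_simps)
  qed
  then have "c * m - \<phi> \<mu> \<le> 0" by (rule nonpos_of_multiples_bounded)
  with le show ?thesis by (simp add: c_def m_def)
qed

end

theorem monotone_additive_statistic_iff: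
  "monotone_additive_statistic S \<phi> \<longleftrightarrow> (\<exists>c\<ge>0. \<forall>\<mu>\<in>S. \<phi> \<mu> = c * (\<integral>x. x \<partial>\<mu>))"
proof
  assume \<phi>: "monotone_additive_statistic S \<phi>"
  have "0 \<le> \<phi> (return borel 1)"
    by (rule statistic_nonneg[OF \<phi> return_mem]) (simp add: integral_return)
  then show "\<exists>c\<ge>0. \<forall>\<mu>\<in>S. \<phi> \<mu> = c * (\<integral>x. x \<partial>\<mu>)"
    using statistic_eq_mean[OF \<phi>] by blast
qed (auto intro: mean_monotone_additive)

end

section \<open>The two families of semigroups\<close>

text \<open>The weight is \<open>exp (a * \<bar>x\<bar>)\<close>, with a rate \<open>a\<close> depending on the measure.\<close>

lemma weighted_semigroup_cramer_measures: "weighted_semigroup cramer_measures"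
proof
  show "convolution_subsemigroup cramer_measures"
    by (rule convolution_subsemigroup_cramer_measures)
  have exp_moment: "\<exists>a>0. (\<integral>\<^sup>+x. ennreal (exp (a * \<bar>x\<bar>)) \<partial>\<mu>) < \<infinity>" if "\<mu> \<in> cramer_measures" for \<mu>
  proof -
    from that have [measurable_cong]: "sets \<mu> = sets borel"
      by (simp add: cramer_measures_def borel_prob_measures_def)
    from that obtain e where "e > 0" and e: "\<And>t. \<bar>t\<bar> < e \<Longrightarrow> moment_generating \<mu> t < \<infinity>"
      by (auto simp: cramer_measures_def eventually_nhds_metric dist_real_def)
    have "(\<integral>\<^sup>+x. ennreal (exp (e / 2 * \<bar>x\<bar>)) \<partial>\<mu>)
        \<le> (\<integral>\<^sup>+x. ennreal (exp (e / 2 * x)) + ennreal (exp (- (e / 2) * x)) \<partial>\<mu>)"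
      by (intro nn_integral_mono) (auto simp: abs_if)
    also have "\<dots> = moment_generating \<mu> (e / 2) + moment_generating \<mu> (- (e / 2))"
      unfolding moment_generating_def by (intro nn_integral_add) auto
    also have "\<dots> < \<infinity>" using e[of "e / 2"] e[of "- (e / 2)"] \<open>e > 0\<close> by simp
    finally show ?thesis using \<open>e > 0\<close> by (intro exI[of _ "e / 2"]) auto
  qed
  show mem: "\<mu> \<in> cramer_measures"
    if "real_distribution \<mu>" "a > 0" "(\<integral>\<^sup>+x. ennreal (exp (a * \<bar>x\<bar>)) \<partial>\<mu>) < \<infinity>" for \<mu> a
  proof -
    have "moment_generating \<mu> t < \<infinity>" if "\<bar>t\<bar> < a" for t
    proof -
      have "t * x \<le> a * \<bar>x\<bar>" for x
      proof -
        have "t * x \<le> \<bar>t\<bar> * \<bar>x\<bar>" by (metis abs_ge_self abs_mult)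
        also have "\<dots> \<le> a * \<bar>x\<bar>" using that by (intro mult_right_mono) auto
        finally show ?thesis .
      qed
      then have "moment_generating \<mu> t \<le> (\<integral>\<^sup>+x. ennreal (exp (a * \<bar>x\<bar>)) \<partial>\<mu>)"
        unfolding moment_generating_def by (intro nn_integral_mono) (auto intro!: ennreal_leI)
      then show ?thesis using \<open>_ < \<infinity>\<close> by (rule le_less_trans)
    qed
    then show ?thesis
      using that borel_prob_measures_iff_real_distribution
      by (auto simp: cramer_measures_def eventually_nhds_metric dist_real_def)
  qed
  show "integrable \<mu> (\<lambda>x. x)" if \<mu>: "\<mu> \<in> cramer_measures" for \<mu>
  proof -
    from \<mu> have [measurable_cong]: "sets \<mu> = sets borel"
      by (simp add: cramer_measures_def borel_prob_measures_def)
    obtain a where a: "a > 0" "(\<integral>\<^sup>+x. ennreal (exp (a * \<bar>x\<bar>)) \<partial>\<mu>) < \<infinity>"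
      using exp_moment[OF \<mu>] by blast
    have "\<bar>x\<bar> \<le> 1 / a * exp (a * \<bar>x\<bar>)" for x
    proof -
      have "a * \<bar>x\<bar> \<le> exp (a * \<bar>x\<bar>)" using exp_ge_add_one_self[of "a * \<bar>x\<bar>"] by linarith
      then show ?thesis using a(1) by (simp add: field_simps)
    qed
    moreover have "integrable \<mu> (\<lambda>x. 1 / a * exp (a * \<bar>x\<bar>))"
      using a by (intro integrable_mult_right integrableI_nonneg) auto
    ultimately show ?thesis
      by (intro Bochner_Integration.integrable_bound[of \<mu> "\<lambda>x. 1 / a * exp (a * \<bar>x\<bar>)" "\<lambda>x. x"])
         (use a in auto)
  qed
  show "\<exists>w. submultiplicative_weight w \<and> (\<integral>\<^sup>+x. ennreal (w x) \<partial>\<mu>) < \<infinity> \<and>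
      (\<forall>\<nu>. real_distribution \<nu> \<longrightarrow> (\<integral>\<^sup>+x. ennreal (w x) \<partial>\<nu>) < \<infinity> \<longrightarrow> \<nu> \<in> cramer_measures)"
    if \<mu>: "\<mu> \<in> cramer_measures" for \<mu>
  proof -
    obtain a where a: "a > 0" "(\<integral>\<^sup>+x. ennreal (exp (a * \<bar>x\<bar>)) \<partial>\<mu>) < \<infinity>"
      using exp_moment[OF \<mu>] by blast
    have "a * \<bar>x + y\<bar> \<le> a * \<bar>x\<bar> + a * \<bar>y\<bar>" for x y
      using a(1) abs_triangle_ineq[of x y] by (simp flip: distrib_left)
    then have "submultiplicative_weight (\<lambda>x. exp (a * \<bar>x\<bar>))"
      using a(1) by (auto simp: submultiplicative_weight_def exp_add[symmetric])
    then show ?thesis using a mem by blast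
  qed
qed

text \<open>The weight is \<open>(1 + \<bar>x\<bar>) powr p\<close>: adding \<open>1\<close> makes the \<open>p\<close>-th power submultiplicative and at
least \<open>1\<close> while leaving the class of integrable probability measures unchanged. The hypothesis
\<open>1 \<le> p\<close> is what provides the mean.\<close>

lemma weighted_semigroup_finite_moment_measures:
  assumes p: "1 \<le> p"
  shows "weighted_semigroup (finite_moment_measures p)"
proof
  show "convolution_subsemigroup (finite_moment_measures p)"
    using p by (intro convolution_subsemigroup_finite_moment_measures) simp
  have mem: "\<mu> \<in> finite_moment_measures p"
    if "real_distribution \<mu>" and fin: "(\<integral>\<^sup>+x. ennreal ((1 + \<bar>x\<bar>) powr p) \<partial>\<mu>) < \<infinity>" for \<mu>
  proof -
    have "(\<integral>\<^sup>+x. ennreal (\<bar>x\<bar> powr p) \<partial>\<mu>) \<le> (\<integral>\<^sup>+x. ennreal ((1 + \<bar>x\<bar>) powr p) \<partial>\<mu>)"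
      using p by (intro nn_integral_mono ennreal_leI powr_mono2) auto
    then have "(\<integral>\<^sup>+x. ennreal (\<bar>x\<bar> powr p) \<partial>\<mu>) < \<infinity>" using fin by (rule le_less_trans)
    then show ?thesis
      using that borel_prob_measures_iff_real_distribution by (simp add: finite_moment_measures_def)
  qed
  have moment: "(\<integral>\<^sup>+x. ennreal ((1 + \<bar>x\<bar>) powr p) \<partial>\<mu>) < \<infinity>" if \<mu>: "\<mu> \<in> finite_moment_measures p" for \<mu>
  proof -
    from \<mu> have [measurable_cong]: "sets \<mu> = sets borel"
      by (simp add: finite_moment_measures_def borel_prob_measures_def)
    interpret prob_space \<mu> using \<mu> by (simp add: finite_moment_measures_def borel_prob_measures_def)
    have "(1 + \<bar>x\<bar>) powr p \<le> 2 powr p * (1 + \<bar>x\<bar> powr p)" for x :: real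
    proof -
      have "(1 + \<bar>x\<bar>) powr p \<le> (2 * max 1 \<bar>x\<bar>) powr p"
        using p by (intro powr_mono2) auto
      also have "\<dots> = 2 powr p * max 1 \<bar>x\<bar> powr p" by (simp add: powr_mult)
      also have "\<dots> \<le> 2 powr p * (1 + \<bar>x\<bar> powr p)"
        by (intro mult_left_mono) (auto simp: max_def)
      finally show ?thesis .
    qed
    then have "(\<integral>\<^sup>+x. ennreal ((1 + \<bar>x\<bar>) powr p) \<partial>\<mu>)
        \<le> (\<integral>\<^sup>+x. ennreal (2 powr p) * (1 + ennreal (\<bar>x\<bar> powr p)) \<partial>\<mu>)"
      by (intro nn_integral_mono) (simp add: ennreal_mult[symmetric] flip: ennreal_plus ennreal_1)
    also have "\<dots> = ennreal (2 powr p) * (1 + (\<integral>\<^sup>+x. ennreal (\<bar>x\<bar> powr p) \<partial>\<mu>))"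
      by (simp add: nn_integral_cmult nn_integral_add emeasure_space_1)
    also have "\<dots> < \<infinity>"
      using \<mu> by (auto simp: finite_moment_measures_def ennreal_mult_less_top)
    finally show ?thesis .
  qed
  show "\<mu> \<in> finite_moment_measures p"
    if "real_distribution \<mu>" "a > 0" "(\<integral>\<^sup>+x. ennreal (exp (a * \<bar>x\<bar>)) \<partial>\<mu>) < \<infinity>" for \<mu> a
  proof (rule mem[OF that(1)])
    interpret real_distribution \<mu> by fact
    \<comment> \<open>From \<open>t \<le> exp t\<close> at \<open>t = a / p * (1 + \<bar>x\<bar>)\<close>, raised to the power \<open>p\<close>.\<close>
    define C where "C = exp a * (p / a) powr p"
    have C: "(1 + \<bar>x\<bar>) powr p \<le> C * exp (a * \<bar>x\<bar>)" for x :: real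
    proof -
      have "(1 + \<bar>x\<bar>) = p / a * (a / p * (1 + \<bar>x\<bar>))" using p that(2) by simp
      also have "\<dots> \<le> p / a * exp (a / p * (1 + \<bar>x\<bar>))"
      proof (rule mult_left_mono)
        show "a / p * (1 + \<bar>x\<bar>) \<le> exp (a / p * (1 + \<bar>x\<bar>))"
          using exp_ge_add_one_self[of "a / p * (1 + \<bar>x\<bar>)"] by linarith
      qed (use p that(2) in simp)
      finally have "(1 + \<bar>x\<bar>) powr p \<le> (p / a * exp (a / p * (1 + \<bar>x\<bar>))) powr p"
        using p by (intro powr_mono2) auto
      also have "\<dots> = (p / a) powr p * exp (a / p * (1 + \<bar>x\<bar>)) powr p"
        by (rule powr_mult)
      also have "\<dots> = (p / a) powr p * exp (a * (1 + \<bar>x\<bar>))"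
        using p by (simp add: exp_powr_real)
      also have "\<dots> = C * exp (a * \<bar>x\<bar>)" by (simp add: C_def distrib_left exp_add)
      finally show ?thesis .
    qed
    have "(\<integral>\<^sup>+x. ennreal ((1 + \<bar>x\<bar>) powr p) \<partial>\<mu>) \<le> (\<integral>\<^sup>+x. ennreal C * ennreal (exp (a * \<bar>x\<bar>)) \<partial>\<mu>)"
      using C by (intro nn_integral_mono) (simp add: ennreal_mult'[symmetric] C_def ennreal_leI)
    also have "\<dots> = ennreal C * (\<integral>\<^sup>+x. ennreal (exp (a * \<bar>x\<bar>)) \<partial>\<mu>)"
      by (intro nn_integral_cmult) simp
    also have "\<dots> < \<infinity>" using that(3) by (simp add: ennreal_mult_less_top)
    finally show "(\<integral>\<^sup>+x. ennreal ((1 + \<bar>x\<bar>) powr p) \<partial>\<mu>) < \<infinity>" .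
  qed
  show "integrable \<mu> (\<lambda>x. x)" if \<mu>: "\<mu> \<in> finite_moment_measures p" for \<mu>
  proof -
    from \<mu> have [measurable_cong]: "sets \<mu> = sets borel"
      by (simp add: finite_moment_measures_def borel_prob_measures_def)
    have "integrable \<mu> (\<lambda>x. (1 + \<bar>x\<bar>) powr p)"
      using moment[OF \<mu>] by (intro integrableI_nonneg) auto
    moreover have "\<bar>x\<bar> \<le> (1 + \<bar>x\<bar>) powr p" for x :: real
      using powr_mono[of 1 p "1 + \<bar>x\<bar>"] p by simp
    ultimately show ?thesis
      by (intro Bochner_Integration.integrable_bound[of \<mu> "\<lambda>x. (1 + \<bar>x\<bar>) powr p" "\<lambda>x. x"]) auto
  qed
  show "\<exists>w. submultiplicative_weight w \<and> (\<integral>\<^sup>+x. ennreal (w x) \<partial>\<mu>) < \<infinity> \<and>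
      (\<forall>\<nu>. real_distribution \<nu> \<longrightarrow> (\<integral>\<^sup>+x. ennreal (w x) \<partial>\<nu>) < \<infinity> \<longrightarrow> \<nu> \<in> finite_moment_measures p)"
    if \<mu>: "\<mu> \<in> finite_moment_measures p" for \<mu>
  proof -
    have "(1 + \<bar>x + y\<bar>) powr p \<le> (1 + \<bar>x\<bar>) powr p * (1 + \<bar>y\<bar>) powr p" for x y :: real
    proof -
      have "1 + \<bar>x + y\<bar> \<le> (1 + \<bar>x\<bar>) * (1 + \<bar>y\<bar>)"
      proof -
        have "(1 + \<bar>x\<bar>) * (1 + \<bar>y\<bar>) = 1 + \<bar>x\<bar> + \<bar>y\<bar> + \<bar>x\<bar> * \<bar>y\<bar>" by (simp add: algebra_simps)
        moreover have "0 \<le> \<bar>x\<bar> * \<bar>y\<bar>" by simp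
        ultimately show ?thesis using abs_triangle_ineq[of x y] by linarith
      qed
      then have "(1 + \<bar>x + y\<bar>) powr p \<le> ((1 + \<bar>x\<bar>) * (1 + \<bar>y\<bar>)) powr p"
        using p by (intro powr_mono2) auto
      then show ?thesis by (simp add: powr_mult)
    qed
    then have "submultiplicative_weight (\<lambda>x. (1 + \<bar>x\<bar>) powr p)"
      using p by (auto simp: submultiplicative_weight_def ge_one_powr_ge_zero)
    then show ?thesis using moment[OF \<mu>] mem by blast
  qed
qed

theorem theorem1:
  fixes S :: "real measure set" and \<phi> :: "real measure \<Rightarrow> real"
  assumes "(\<exists>p\<ge>1. S = finite_moment_measures p) \<or> S = cramer_measures"
  shows "monotone_additive_statistic S \<phi> \<longleftrightarrow>
    (\<exists>c\<ge>0. \<forall>\<mu>\<in>S. \<phi> \<mu> = c * (\<integral>x. x \<partial>\<mu>))"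
proof -
  have "weighted_semigroup S"
    using assms weighted_semigroup_finite_moment_measures weighted_semigroup_cramer_measures by auto
  then show ?thesis by (rule weighted_semigroup.monotone_additive_statistic_iff)
qed

end
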